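(* Suppose that $f$ is $l_f$-smooth and bounded below, and that $A$ is full row rank. Fix $k$ and the current point $(w^k;u^k;z^k;v^k)$, and suppose the parameters $\alpha$, $\{Q_{k,j}\}_{j\in\mathbb{N}}$ and $t$ satisfy $$\alpha=\frac1\rho,\qquad \sup_{j\in\mathbb{N}}\|Q_{k,j}\|\le q,\qquad t>q+l_g,$$ where $q$ is a positive constant. Let $\{(w^{k,j},u^{k,j})\}_{j\in\mathbb{N}}$ be a sequence generated by 0/1-BALM. Then: (i) With $\zeta:=t-q-l_g>0$, $$\mathcal{V}_{\rho,\mu}(w^{k,j},u^{k,j},z^k,v^k)-\mathcal{V}_{\rho,\mu}(w^{k,j+1},u^{k,j+1},z^k,v^k)\ge\frac{\zeta}{2}\|w^{k,j+1}-w^{k,j}\|^2,\quad\forall j\in\mathbb{N}.$$ (ii) $\lim_{j\to\infty}\|w^{k,j+1}-w^{k,j}\|=0$ and $\lim_{j\to\infty}\|u^{k,j+1}-u^{k,j}\|=0$. (iii) The sequence $\{(w^{k,j},u^{k,j})\}_{j\in\mathbb{N}}$ is bounded. (iv) Each accumulation point of $\{(w^{k,j},u^{k,j})\}_{j\in\mathbb{N}}$ is a ${\rm P}^k$-stationary point. Moreover, $\lim_{j\to\infty}\nabla_w h_k(w^{k,j},u^{k,j})=0$. (v) If $f$ is a convex function, then the sequence $\{(w^{k,j},u^{k,j})\}_{j\in\mathbb{N}}$ converges to a ${\rm P}^k$-stationary point.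
   Context: Setting: $f:\mathbb{R}^p\to\mathbb{R}$ is continuously differentiable, $A\in\mathbb{R}^{n\times p}$, $b\in\mathbb{R}^n$, $\lambda,\rho,\mu>0$. A function is $l$-smooth if its gradient is Lipschitz continuous with constant $l$. For $u\in\mathbb{R}^n$, $u_+:=(\max\{0,u_i\})_{i}$ and $\|u\|_0$ counts nonzero components. $\|x\|_P^2:=x^\top Px$; $(w;u)$ denotes concatenation. Lyapunov function: $\mathcal{V}_{\rho,\mu}(w,u,z,v):=f(w)+\lambda\|u_+\|_0+\langle z,Aw+b-u\rangle+\frac{\rho}{2}\|Aw+b-u\|^2+\frac{\mu}{2}\|w-v\|^2$. Proximal operator (set-valued): ${\rm Prox}_{\alpha\lambda\|(\cdot)_+\|_0}(z):=\arg\min_{u\in\mathbb{R}^n}\ \lambda\|u_+\|_0+\frac{1}{2\alpha}\|u-z\|^2$. For the given $(w^k;u^k;z^k;v^k)\in\mathbb{R}^p\times\mathbb{R}^n\times\mathbb{R}^n\times\mathbb{R}^p$, let $$h_k(w,u):=f(w)+\frac{\mu}{2}\|w-v^k\|^2+\langle z^k,Aw+b-u\rangle+\frac{\rho}{2}\|Aw+b-u\|^2,$$ so that the subproblem is $\min_{w,u}\mathcal{V}_{\rho,\mu}(w,u,z^k,v^k)=h_k(w,u)+\lambda\|u_+\|_0$. ${\rm P}^k$-stationary point: $(\widehat w;\widehat u)$ for which there exist $\widehat z\in\mathbb{R}^n$ and a constant $\alpha>0$ with $\nabla f(\widehat w)+\mu(\widehat w-v^k)+A^\top\widehat z=0$,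 $\widehat u\in{\rm Prox}_{\alpha\lambda\|(\cdot)_+\|_0}(\widehat u+\alpha\widehat z)$, $\widehat z=z^k+\rho(A\widehat w+b-\widehat u)$. 0/1-BALM (zero-one Bregman alternating linearized minimization): let $t>0$, let $Q_{k,j}\in\mathbb{R}^{p\times p}$ be symmetric positive semidefinite, $P_{k,j}:=tI-Q_{k,j}$, let $g:\mathbb{R}^p\to\mathbb{R}$ be $l_g$-smooth, and set $\psi_{k,j}(w):=\frac12\|w\|_{P_{k,j}}^2-g(w)$ and $\mathcal{D}_{\psi_{k,j}}(w,w^{k,j}):=\psi_{k,j}(w)-\psi_{k,j}(w^{k,j})-\langle\nabla\psi_{k,j}(w^{k,j}),w-w^{k,j}\rangle$. Take $\alpha=1/\rho$ and start from $(w^{k,0};u^{k,0})=(w^k;u^k)$. For $j=0,1,\dots$: u-step: $u^{k,j+1}\in{\rm Prox}_{\alpha\lambda\|(\cdot)_+\|_0}\big(u^{k,j}-\alpha\nabla_uh_k(w^{k,j},u^{k,j})\big)$; w-step: $w^{k,j+1}\in\arg\min_{w\in\mathbb{R}^p}\ h_k(w,u^{k,j+1})+\mathcal{D}_{\psi_{k,j}}(w,w^{k,j})$. *)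

theory Defs
  imports "HOL-Analysis.Analysis"
begin

text \<open>Where the function is not differentiable, \<open>gradient\<close> is unspecified, so differentiability
  is a separate requirement in the smoothness notions below.\<close>

definition gradient :: "('a::real_inner \<Rightarrow> real) \<Rightarrow> 'a \<Rightarrow> 'a" where
  "gradient f x = (THE D. GDERIV f x :> D)"

lemma gradient_eqI:
  assumes "GDERIV f x :> D"
  shows "gradient f x = D"
  unfolding gradient_def
proof (rule the_equality)
  fix E assume "GDERIV f x :> E"
  with assms have "(\<lambda>h. inner h D) = (\<lambda>h. inner h E)"
    unfolding gderiv_def by (rule has_derivative_unique)
  then have "inner (E - D) E = inner (E - D) D"
    by metis
  then have "inner (E - D) (E - D) = 0"
    by (simp add: inner_diff_right)
  then show "E = D"
    by simp
qed (rule assms)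

definition cont_diff :: "('a::real_inner \<Rightarrow> real) \<Rightarrow> bool" where
  "cont_diff f \<longleftrightarrow> (\<forall>x. f differentiable (at x)) \<and> continuous_on UNIV (gradient f)"

definition smooth_with :: "real \<Rightarrow> ('a::real_inner \<Rightarrow> real) \<Rightarrow> bool" where
  "smooth_with l f \<longleftrightarrow> (\<forall>x. f differentiable (at x)) \<and> l-lipschitz_on UNIV (gradient f)"

definition argmin :: "('a \<Rightarrow> real) \<Rightarrow> 'a set" where
  "argmin F = {x. is_arg_min F (\<lambda>_. True) x}"

definition pos_part :: "real ^ 'n \<Rightarrow> real ^ 'n" where
  "pos_part u = (\<chi> i. max 0 (u $ i))"

definition norm0 :: "real ^ 'n \<Rightarrow> nat" where
  "norm0 u = card {i. u $ i \<noteq> 0}"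

definition prox01 :: "real \<Rightarrow> real \<Rightarrow> real ^ 'n \<Rightarrow> (real ^ 'n) set" where
  "prox01 \<alpha> lam z = argmin (\<lambda>u. lam * real (norm0 (pos_part u)) + 1 / (2 * \<alpha>) * (norm (u - z))\<^sup>2)"

definition sym_psd :: "real ^ 'p ^ 'p \<Rightarrow> bool" where
  "sym_psd Q \<longleftrightarrow> transpose Q = Q \<and> (\<forall>x. 0 \<le> x \<bullet> (Q *v x))"

definition lyapunov ::
  "(real ^ 'p \<Rightarrow> real) \<Rightarrow> real ^ 'p ^ 'n \<Rightarrow> real ^ 'n \<Rightarrow> real \<Rightarrow> real \<Rightarrow> real \<Rightarrow>
    real ^ 'p \<Rightarrow> real ^ 'n \<Rightarrow> real ^ 'n \<Rightarrow> real ^ 'p \<Rightarrow> real" where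
  "lyapunov f A b lam \<rho> \<mu> w u z v =
     f w + lam * real (norm0 (pos_part u)) + z \<bullet> (A *v w + b - u)
       + \<rho> / 2 * (norm (A *v w + b - u))\<^sup>2 + \<mu> / 2 * (norm (w - v))\<^sup>2"

definition subproblem_smooth ::
  "(real ^ 'p \<Rightarrow> real) \<Rightarrow> real ^ 'p ^ 'n \<Rightarrow> real ^ 'n \<Rightarrow> real \<Rightarrow> real \<Rightarrow>
    real ^ 'n \<Rightarrow> real ^ 'p \<Rightarrow> real ^ 'p \<Rightarrow> real ^ 'n \<Rightarrow> real" where
  "subproblem_smooth f A b \<rho> \<mu> zk vk w u =
     f w + \<mu> / 2 * (norm (w - vk))\<^sup>2 + zk \<bullet> (A *v w + b - u)
       + \<rho> / 2 * (norm (A *v w + b - u))\<^sup>2"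

definition P_stationary ::
  "(real ^ 'p \<Rightarrow> real) \<Rightarrow> real ^ 'p ^ 'n \<Rightarrow> real ^ 'n \<Rightarrow> real \<Rightarrow> real \<Rightarrow> real \<Rightarrow>
    real ^ 'n \<Rightarrow> real ^ 'p \<Rightarrow> (real ^ 'p) \<times> (real ^ 'n) \<Rightarrow> bool" where
  "P_stationary f A b lam \<rho> \<mu> zk vk = (\<lambda>(w, u).
     \<exists>z. \<exists>\<alpha>>0.
       gradient f w + \<mu> *\<^sub>R (w - vk) + transpose A *v z = 0 \<and>
       u \<in> prox01 \<alpha> lam (u + \<alpha> *\<^sub>R z) \<and>
       z = zk + \<rho> *\<^sub>R (A *v w + b - u))"

definition bregman :: "('a::real_inner \<Rightarrow> real) \<Rightarrow> 'a \<Rightarrow> 'a \<Rightarrow> real" where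
  "bregman \<psi> x y = \<psi> x - \<psi> y - gradient \<psi> y \<bullet> (x - y)"

definition balm_kernel ::
  "real \<Rightarrow> real ^ 'p ^ 'p \<Rightarrow> (real ^ 'p \<Rightarrow> real) \<Rightarrow> real ^ 'p \<Rightarrow> real" where
  "balm_kernel t Q g w = 1 / 2 * (w \<bullet> ((t *\<^sub>R mat 1 - Q) *v w)) - g w"

text \<open>Both steps choose an arbitrary element of a possibly non-singleton set of minimizers, so this
  is a relation satisfied by every sequence the algorithm may produce.\<close>

definition balm_sequence ::
  "(real ^ 'p \<Rightarrow> real) \<Rightarrow> real ^ 'p ^ 'n \<Rightarrow> real ^ 'n \<Rightarrow> real \<Rightarrow> real \<Rightarrow> real \<Rightarrow>
    real \<Rightarrow> real \<Rightarrow> (nat \<Rightarrow> real ^ 'p ^ 'p) \<Rightarrow> (real ^ 'p \<Rightarrow> real) \<Rightarrow>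
    real ^ 'p \<Rightarrow> real ^ 'n \<Rightarrow> real ^ 'n \<Rightarrow> real ^ 'p \<Rightarrow>
    (nat \<Rightarrow> real ^ 'p) \<Rightarrow> (nat \<Rightarrow> real ^ 'n) \<Rightarrow> bool" where
  "balm_sequence f A b lam \<rho> \<mu> \<alpha> t Q g wk uk zk vk w u \<longleftrightarrow>
     w 0 = wk \<and> u 0 = uk \<and>
     (\<forall>j. u (Suc j) \<in> prox01 \<alpha> lam
              (u j - \<alpha> *\<^sub>R gradient (\<lambda>y. subproblem_smooth f A b \<rho> \<mu> zk vk (w j) y) (u j)) \<and>
          w (Suc j) \<in> argmin
              (\<lambda>x. subproblem_smooth f A b \<rho> \<mu> zk vk x (u (Suc j))
                     + bregman (balm_kernel t (Q j) g) x (w j)))"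

text \<open>Accumulation points are those of the sequence, not limit points of its range: a value that is
  taken infinitely often counts.\<close>

definition accumulation_point :: "(nat \<Rightarrow> 'a::topological_space) \<Rightarrow> 'a \<Rightarrow> bool" where
  "accumulation_point X x \<longleftrightarrow> (\<exists>r::nat \<Rightarrow> nat. strict_mono r \<and> (X \<circ> r) \<longlonglongrightarrow> x)"

end

theory Submission
  imports Defs
begin

text \<open>Everything rests on reading the iteration as alternating minimisation. Completing the square in
  the residual \<open>A w + b - u\<close> turns the Lyapunov function, as a function of \<open>u\<close>, into a constant
  plus the objective of the proximal operator with step \<open>1 / \<rho>\<close> at the point \<open>A w + b + z / \<rho>\<close>
  (\<open>lyapunov_complete_square\<close>). A gradient step of that same length from any \<open>u\<close> lands exactly at
  this point, so the \<open>u\<close>-step is an exact minimisation in \<open>u\<close>. The \<open>w\<close>-step minimises the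
  Lyapunov function plus a Bregman distance, and this distance dominates half of
  \<open>t - q - lg\<close> times the squared step (\<open>bregman_balm_kernel_ge\<close>). Adding the two gives the
  descent inequality.

  The same completed square bounds the Lyapunov function below, so its decrements tend to zero, and
  hence so do the steps in \<open>w\<close>; it is also coercive in \<open>(w, u)\<close>, whence boundedness. The
  optimality condition of the \<open>w\<close>-step expresses the \<open>w\<close>-gradient of the smooth part at the new
  iterate through the step in \<open>w\<close>, so this gradient tends to zero. It contains \<open>u\<close> only
  through \<open>A\<^sup>T u\<close>, and \<open>A\<^sup>T\<close> is injective because \<open>A\<close> has full row rank; this forces the steps
  in \<open>u\<close> to zero although the proximal operator is discontinuous. Limits of subsequences are
  stationary because the gradient is continuous and the proximal operator has a closed graph.

  In the convex case a positive entry of an output of the proximal operator is at least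
  \<open>sqrt (2 * lam / \<rho>)\<close>. Once the steps in \<open>u\<close> are shorter than that, no entry can change
  between positive and nonpositive, so all accumulation points have the same set of positive
  entries. For a prescribed set of positive entries the stationarity conditions are the KKT
  conditions of a strongly convex problem, hence have at most one solution (\<open>stationary_unique\<close>).
  A bounded sequence with a single accumulation point converges.\<close>

section \<open>Gradients\<close>

text \<open>The Riesz representative of the derivative is its adjoint applied to 1.\<close>

lemma GDERIV_gradient:
  fixes f :: "'a::euclidean_space \<Rightarrow> real"
  assumes "f differentiable (at x)"
  shows "GDERIV f x :> gradient f x"
proof -
  obtain f' where f': "(f has_derivative f') (at x)"
    using assms by (auto simp: differentiable_def)
  then have "linear f'"
    by (rule has_derivative_linear)
  then have "f' h = h \<bullet> adjoint f' 1" for h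
    by (simp add: adjoint_works)
  then have "f' = (\<lambda>h. h \<bullet> adjoint f' 1)"
    by blast
  then have "GDERIV f x :> adjoint f' 1"
    using f' unfolding gderiv_def by metis
  then show ?thesis
    using gradient_eqI by metis
qed

lemma smooth_with_GDERIV:
  fixes f :: "'a::euclidean_space \<Rightarrow> real"
  assumes "smooth_with l f"
  shows "GDERIV f x :> gradient f x"
  using assms by (simp add: smooth_with_def GDERIV_gradient)

lemma smooth_with_gradient_diff_le:
  assumes "smooth_with l f"
  shows "norm (gradient f x - gradient f y) \<le> l * norm (x - y)"
  using assms by (auto simp: smooth_with_def dist_norm dest: lipschitz_onD)

lemma GDERIV_along_line:
  assumes "GDERIV f (x + s *\<^sub>R d) :> D"
  shows "((\<lambda>s. f (x + s *\<^sub>R d)) has_real_derivative d \<bullet> D) (at s)"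
proof -
  have "((\<lambda>s. x + s *\<^sub>R d) has_derivative (\<lambda>h. h *\<^sub>R d)) (at s)"
    by (auto intro!: derivative_eq_intros)
  then have "((\<lambda>s. f (x + s *\<^sub>R d)) has_derivative (\<lambda>h. (h *\<^sub>R d) \<bullet> D)) (at s)"
    using assms unfolding gderiv_def by (rule has_derivative_compose)
  then show ?thesis
    by (simp add: has_field_derivative_def mult.commute [of _ "d \<bullet> D"])
qed

text \<open>The descent lemma. Along the segment, the difference of the two sides, up to the constant
  \<open>f x\<close>, has derivative at most 0 by Cauchy-Schwarz and the Lipschitz bound, so it is enough to
  compare the endpoints.\<close>

lemma smooth_with_upper_bound:
  fixes f :: "'a::euclidean_space \<Rightarrow> real"
  assumes f: "smooth_with l f"
  shows "f y - f x - gradient f x \<bullet> (y - x) \<le> l / 2 * (norm (y - x))\<^sup>2"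
proof -
  define d where "d = y - x"
  define p where "p s = f (x + s *\<^sub>R d) - s * (d \<bullet> gradient f x) - l / 2 * s\<^sup>2 * (norm d)\<^sup>2" for s
  have p': "(p has_real_derivative
      d \<bullet> gradient f (x + s *\<^sub>R d) - d \<bullet> gradient f x - l * s * (norm d)\<^sup>2) (at s)" for s
    unfolding p_def
    by (auto intro!: derivative_eq_intros GDERIV_along_line smooth_with_GDERIV [OF f])
  have "p 1 \<le> p 0"
  proof (rule DERIV_nonpos_imp_nonincreasing [where f = p])
    fix s :: real
    assume s: "0 \<le> s" "s \<le> 1"
    have "d \<bullet> (gradient f (x + s *\<^sub>R d) - gradient f x)
        \<le> norm d * norm (gradient f (x + s *\<^sub>R d) - gradient f x)"
      by (rule norm_cauchy_schwarz)
    also have "\<dots> \<le> norm d * (l * norm (s *\<^sub>R d))"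
      using smooth_with_gradient_diff_le [OF f, of "x + s *\<^sub>R d" x]
      by (intro mult_left_mono) auto
    also have "\<dots> = l * s * (norm d)\<^sup>2"
      using s by (simp add: power2_eq_square)
    finally show "\<exists>D. (p has_real_derivative D) (at s) \<and> D \<le> 0"
      using p' [of s] by (auto simp: inner_diff_right)
  qed simp
  then show ?thesis
    by (simp add: p_def d_def inner_commute)
qed

lemma convex_on_above_tangent:
  assumes f: "convex_on UNIV f" and D: "GDERIV f x :> D"
  shows "f x + D \<bullet> (y - x) \<le> f y"
proof -
  define p where "p s = f (x + s *\<^sub>R (y - x))" for s
  have "convex_on UNIV p"
  proof (rule convex_onI)
    fix \<theta> r s :: real
    assume "0 < \<theta>" "\<theta> < 1"
    moreover have "x + ((1 - \<theta>) *\<^sub>R r + \<theta> *\<^sub>R s) *\<^sub>R (y - x)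
        = (1 - \<theta>) *\<^sub>R (x + r *\<^sub>R (y - x)) + \<theta> *\<^sub>R (x + s *\<^sub>R (y - x))"
      by (simp add: algebra_simps)
    ultimately show "p ((1 - \<theta>) *\<^sub>R r + \<theta> *\<^sub>R s) \<le> (1 - \<theta>) * p r + \<theta> * p s"
      using convex_onD [OF f, of \<theta> "x + r *\<^sub>R (y - x)" "x + s *\<^sub>R (y - x)"]
      by (simp add: p_def)
  qed simp
  moreover have "(p has_real_derivative (y - x) \<bullet> D) (at 0)"
    unfolding p_def by (rule GDERIV_along_line) (simp add: D)
  ultimately have "((y - x) \<bullet> D) * (1 - 0) \<le> p 1 - p 0"
    by (intro convex_on_imp_above_tangent [where A = UNIV]) auto
  then show ?thesis
    by (simp add: p_def inner_commute)
qed

lemma convex_on_gradient_monotone: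
  fixes f :: "'a::euclidean_space \<Rightarrow> real"
  assumes f: "convex_on UNIV f" and df: "\<And>x. GDERIV f x :> gradient f x"
  shows "0 \<le> (gradient f x - gradient f y) \<bullet> (x - y)"
  using convex_on_above_tangent [OF f df, of x y] convex_on_above_tangent [OF f df, of y x]
  by (simp add: inner_diff_left inner_diff_right)

lemma argmin_iff: "x \<in> argmin F \<longleftrightarrow> (\<forall>y. F x \<le> F y)"
  by (auto simp: argmin_def is_arg_min_def not_less)

lemma GDERIV_argmin_eq_0:
  fixes F :: "'a::euclidean_space \<Rightarrow> real"
  assumes "x \<in> argmin F" and "GDERIV F x :> D"
  shows "D = 0"
proof -
  have "(\<lambda>h. h \<bullet> D) = (\<lambda>h. 0)"
    using assms by (intro differential_zero_maxmin [of x UNIV F]) (auto simp: gderiv_def argmin_iff)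
  then have "D \<bullet> D = 0"
    by metis
  then show ?thesis
    by simp
qed

section \<open>The proximal operator\<close>

lemma norm0_pos_part: "norm0 (pos_part u) = card {i. u $ i > 0}"
  unfolding norm0_def pos_part_def by (rule arg_cong [where f = card]) (auto simp: max_def)

lemma norm0_pos_part_eq_sum:
  "real (norm0 (pos_part u)) = (\<Sum>i\<in>UNIV. if u $ i > 0 then 1 else 0)"
  by (simp add: norm0_pos_part sum.If_cases)

text \<open>The proximal objective is a sum of functions of single coordinates, so a minimiser minimises
  each of them.\<close>

lemma prox01_component_min:
  fixes u s :: "real ^ 'n"
  assumes "u \<in> prox01 \<alpha> lam s"
  shows "lam * (if u $ i > 0 then 1 else 0) + 1 / (2 * \<alpha>) * (u $ i - s $ i)\<^sup>2
       \<le> lam * (if x > 0 then 1 else 0) + 1 / (2 * \<alpha>) * (x - s $ i)\<^sup>2"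
proof -
  define \<phi> where "\<phi> i x = lam * (if x > 0 then 1 else 0) + 1 / (2 * \<alpha>) * (x - s $ i)\<^sup>2" for i x
  have J: "lam * real (norm0 (pos_part y)) + 1 / (2 * \<alpha>) * (norm (y - s))\<^sup>2
      = (\<Sum>i\<in>UNIV. \<phi> i (y $ i))" for y
    by (simp add: norm0_pos_part_eq_sum \<phi>_def norm_vec_def L2_set_def sum_nonneg sum.distrib
        sum_distrib_left)
  define v where "v = (\<chi> k. if k = i then x else u $ k)"
  have "(\<Sum>k\<in>UNIV. \<phi> k (u $ k)) \<le> (\<Sum>k\<in>UNIV. \<phi> k (v $ k))"
    using assms unfolding prox01_def argmin_iff J by blast
  moreover have "(\<Sum>k\<in>UNIV. \<phi> k (y $ k)) = \<phi> i (y $ i) + (\<Sum>k\<in>UNIV - {i}. \<phi> k (y $ k))" for y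
    by (rule sum.remove) auto
  moreover have "(\<Sum>k\<in>UNIV - {i}. \<phi> k (u $ k)) = (\<Sum>k\<in>UNIV - {i}. \<phi> k (v $ k))"
    by (rule sum.cong) (auto simp: v_def)
  ultimately have "\<phi> i (u $ i) \<le> \<phi> i (v $ i)"
    by simp
  then show ?thesis
    by (simp add: \<phi>_def v_def)
qed

text \<open>Comparison with \<open>s $ i\<close> gives the value; comparison with 0 shows that paying the price \<open>lam\<close>
  for a positive entry is worthwhile only if the entry is large. This gap around 0 is what later
  freezes the set of positive entries.\<close>

lemma prox01_component_pos:
  fixes u s :: "real ^ 'n"
  assumes u: "u \<in> prox01 \<alpha> lam s" and "\<alpha> > 0" and pos: "u $ i > 0" and "lam > 0"
  shows "u $ i = s $ i" and "2 * \<alpha> * lam \<le> (u $ i)\<^sup>2"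
proof -
  have "(u $ i - s $ i)\<^sup>2 / (2 * \<alpha>) \<le> 0"
    using prox01_component_min [OF u, of i "s $ i"] pos \<open>lam > 0\<close> by (auto split: if_splits)
  then have "(u $ i - s $ i)\<^sup>2 \<le> 0"
    using \<open>\<alpha> > 0\<close> by (simp add: divide_le_0_iff)
  then show eq: "u $ i = s $ i"
    by simp
  show "2 * \<alpha> * lam \<le> (u $ i)\<^sup>2"
    using prox01_component_min [OF u, of i 0] pos \<open>\<alpha> > 0\<close> by (simp add: eq field_simps)
qed

lemma prox01_component_nonpos:
  fixes u s :: "real ^ 'n"
  assumes u: "u \<in> prox01 \<alpha> lam s" and "\<alpha> > 0" and nonpos: "u $ i \<le> 0"
  shows "u $ i = min 0 (s $ i)"
proof -
  have "(u $ i - s $ i)\<^sup>2 / (2 * \<alpha>) \<le> (min 0 (s $ i) - s $ i)\<^sup>2 / (2 * \<alpha>)"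
    using prox01_component_min [OF u, of i "min 0 (s $ i)"] nonpos by auto
  then have le: "(u $ i - s $ i)\<^sup>2 \<le> (min 0 (s $ i) - s $ i)\<^sup>2"
    using \<open>\<alpha> > 0\<close> by (simp add: divide_le_cancel)
  show ?thesis
  proof (cases "s $ i \<le> 0")
    case True
    then show ?thesis
      using le by (simp add: min_def)
  next
    case False
    then have "\<bar>u $ i - s $ i\<bar> \<le> \<bar>s $ i\<bar>"
      using le unfolding abs_le_square_iff by (simp add: min_def)
    then show ?thesis
      using False nonpos by (simp add: min_def)
  qed
qed

text \<open>The count of positive entries is lower semicontinuous, because entries positive in the limit are
  positive eventually. The rest of the objective is continuous, so minimality passes to the
  limit.\<close>

lemma prox01_closed_graph:
  fixes X S :: "nat \<Rightarrow> real ^ 'n"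
  assumes XS: "\<And>j. X j \<in> prox01 \<alpha> lam (S j)" and X: "X \<longlonglongrightarrow> x" and S: "S \<longlonglongrightarrow> s" and "lam \<ge> 0"
  shows "x \<in> prox01 \<alpha> lam s"
proof -
  have "\<forall>\<^sub>F j in sequentially. \<forall>i. x $ i > 0 \<longrightarrow> X j $ i > 0"
  proof (rule eventually_all_finite)
    fix i
    show "\<forall>\<^sub>F j in sequentially. x $ i > 0 \<longrightarrow> X j $ i > 0"
      using order_tendstoD(1) [OF tendsto_vec_nth [OF X, of i], of 0]
      by (cases "x $ i > 0") auto
  qed
  then have N: "\<forall>\<^sub>F j in sequentially. norm0 (pos_part x) \<le> norm0 (pos_part (X j))"
    by eventually_elim (auto simp: norm0_pos_part intro: card_mono)
  show ?thesis
    unfolding prox01_def argmin_iff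
  proof
    fix y
    show "lam * real (norm0 (pos_part x)) + 1 / (2 * \<alpha>) * (norm (x - s))\<^sup>2
        \<le> lam * real (norm0 (pos_part y)) + 1 / (2 * \<alpha>) * (norm (y - s))\<^sup>2" (is "?l \<le> ?r")
    proof -
      have r: "(\<lambda>j. lam * real (norm0 (pos_part y)) + 1 / (2 * \<alpha>) * (norm (y - S j))\<^sup>2) \<longlonglongrightarrow> ?r"
        by (intro tendsto_intros X S)
      have l: "(\<lambda>j. lam * real (norm0 (pos_part x)) + 1 / (2 * \<alpha>) * (norm (X j - S j))\<^sup>2) \<longlonglongrightarrow> ?l"
        by (intro tendsto_intros X S)
      have "\<forall>\<^sub>F j in sequentially. lam * real (norm0 (pos_part x)) + 1 / (2 * \<alpha>) * (norm (X j - S j))\<^sup>2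
          \<le> lam * real (norm0 (pos_part y)) + 1 / (2 * \<alpha>) * (norm (y - S j))\<^sup>2"
        using N
      proof eventually_elim
        case (elim j)
        then have "lam * real (norm0 (pos_part x)) \<le> lam * real (norm0 (pos_part (X j)))"
          using \<open>lam \<ge> 0\<close> by (intro mult_left_mono) auto
        then show ?case
          using XS [of j] unfolding prox01_def argmin_iff by (meson add_right_mono order_trans)
      qed
      then show ?thesis
        by (rule tendsto_le [OF sequentially_bot r l])
    qed
  qed
qed

section \<open>The subproblem and the Bregman distance\<close>

lemma inner_transpose: "x \<bullet> (transpose A *v y) = (A *v x) \<bullet> (y :: real ^ 'n)"
  by (metis dot_lmul_matrix inner_commute transpose_matrix_vector)

lemma inner_vector_matrix: "x \<bullet> (y v* A) = (A *v x) \<bullet> (y :: real ^ 'n)"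
  by (metis dot_lmul_matrix inner_commute)

lemma GDERIV_subproblem_u:
  "GDERIV (\<lambda>y. subproblem_smooth f A b \<rho> \<mu> zk vk x y) y :> - zk - \<rho> *\<^sub>R (A *v x + b - y)"
  unfolding gderiv_def subproblem_smooth_def power2_norm_eq_inner
  by (auto intro!: derivative_eq_intros
      simp: fun_eq_iff inner_simps algebra_simps inner_commute)

definition subproblem_grad ::
  "(real ^ 'p \<Rightarrow> real) \<Rightarrow> real ^ 'p ^ 'n \<Rightarrow> real ^ 'n \<Rightarrow> real \<Rightarrow> real \<Rightarrow>
    real ^ 'n \<Rightarrow> real ^ 'p \<Rightarrow> real ^ 'p \<Rightarrow> real ^ 'n \<Rightarrow> real ^ 'p" where
  "subproblem_grad f A b \<rho> \<mu> zk vk x y =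
     gradient f x + \<mu> *\<^sub>R (x - vk) + transpose A *v (zk + \<rho> *\<^sub>R (A *v x + b - y))"

lemma GDERIV_subproblem_w:
  assumes "GDERIV f x :> gradient f x"
  shows "GDERIV (\<lambda>x. subproblem_smooth f A b \<rho> \<mu> zk vk x y) x
    :> subproblem_grad f A b \<rho> \<mu> zk vk x y"
  using assms
  unfolding gderiv_def subproblem_smooth_def subproblem_grad_def power2_norm_eq_inner
  by (auto intro!: derivative_eq_intros
        bounded_linear.has_derivative [OF matrix_vector_mul_bounded_linear]
      simp: fun_eq_iff inner_add_right inner_diff_right inner_diff_left inner_add_left
        inner_vector_matrix dot_lmul_matrix inner_commute algebra_simps)

lemma lyapunov_eq_subproblem:
  "lyapunov f A b lam \<rho> \<mu> x y z v
    = subproblem_smooth f A b \<rho> \<mu> z v x y + lam * real (norm0 (pos_part y))"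
  by (simp add: lyapunov_def subproblem_smooth_def)

text \<open>In this form the dependence on \<open>y\<close> is exactly the objective of
  \<open>prox01 (1 / \<rho>) lam (A *v x + b + (1 / \<rho>) *\<^sub>R z)\<close>, written literally as in that definition.\<close>

lemma lyapunov_complete_square:
  fixes z :: "real ^ 'n"
  assumes "\<rho> > 0"
  shows "lyapunov f A b lam \<rho> \<mu> x y z v =
    f x + \<mu> / 2 * (norm (x - v))\<^sup>2 - (norm z)\<^sup>2 / (2 * \<rho>)
    + (lam * real (norm0 (pos_part y))
       + 1 / (2 * (1 / \<rho>)) * (norm (y - (A *v x + b + (1 / \<rho>) *\<^sub>R z)))\<^sup>2)"
proof -
  define r where "r = A *v x + b - y"
  have "y - (A *v x + b + (1 / \<rho>) *\<^sub>R z) = - (r + (1 / \<rho>) *\<^sub>R z)"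
    by (simp add: r_def)
  then have n: "norm (y - (A *v x + b + (1 / \<rho>) *\<^sub>R z)) = norm (r + (1 / \<rho>) *\<^sub>R z)"
    by (simp only: norm_minus_cancel)
  have "\<rho> * (norm (r + (1 / \<rho>) *\<^sub>R z))\<^sup>2 = \<rho> * (norm r)\<^sup>2 + 2 * (z \<bullet> r) + (norm z)\<^sup>2 / \<rho>"
    using assms
    by (simp add: power2_norm_eq_inner inner_simps inner_commute field_simps)
  then show ?thesis
    unfolding n by (simp add: lyapunov_def flip: r_def) (simp add: field_simps)
qed

lemma balm_kernel_eq:
  "balm_kernel t Q g x = t / 2 * (x \<bullet> x) - 1 / 2 * (x \<bullet> (Q *v x)) - g x"
  by (simp add: balm_kernel_def matrix_vector_mult_diff_rdistrib inner_diff_right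
      scaleR_matrix_vector_assoc [symmetric] algebra_simps)

lemma GDERIV_balm_kernel:
  assumes Q: "transpose Q = Q" and g: "GDERIV g x :> gradient g x"
  shows "GDERIV (balm_kernel t Q g) x :> t *\<^sub>R x - Q *v x - gradient g x"
proof -
  have "(balm_kernel t Q g has_derivative (\<lambda>h. t / 2 * (x \<bullet> h + h \<bullet> x)
      - 1 / 2 * (x \<bullet> (Q *v h) + h \<bullet> (Q *v x)) - h \<bullet> gradient g x)) (at x)"
    using g unfolding gderiv_def balm_kernel_eq [abs_def]
    by (auto intro!: derivative_eq_intros
        bounded_linear.has_derivative [OF matrix_vector_mul_bounded_linear])
  moreover have "t / 2 * (x \<bullet> h + h \<bullet> x) - 1 / 2 * (x \<bullet> (Q *v h) + h \<bullet> (Q *v x))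
      - h \<bullet> gradient g x = h \<bullet> (t *\<^sub>R x - Q *v x - gradient g x)" for h
  proof -
    have "x \<bullet> (Q *v h) = h \<bullet> (Q *v x)"
      using inner_transpose [of h Q x] Q by (simp add: inner_commute)
    then show ?thesis
      by (simp add: inner_diff_right inner_commute [of x h])
  qed
  ultimately show ?thesis
    unfolding gderiv_def by simp
qed

lemma GDERIV_bregman:
  fixes \<psi> :: "'a::euclidean_space \<Rightarrow> real"
  assumes "GDERIV \<psi> x :> D"
  shows "GDERIV (\<lambda>x. bregman \<psi> x y) x :> D - gradient \<psi> y"
  using assms unfolding gderiv_def bregman_def
  by (auto intro!: derivative_eq_intros simp: fun_eq_iff inner_simps inner_commute)

text \<open>The Bregman distance is additive in the kernel: the quadratic part contributes half of
  \<open>(x - y) \<bullet> ((t I - Q) (x - y))\<close>, bounded through the operator norm of \<open>Q\<close>, and \<open>- g\<close> loses at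
  most what the descent lemma allows.\<close>

lemma bregman_balm_kernel_ge:
  fixes Q :: "real ^ 'p ^ 'p"
  assumes Q: "transpose Q = Q" and q: "\<And>x. norm (Q *v x) \<le> q * norm x" and g: "smooth_with lg g"
  shows "(t - q - lg) / 2 * (norm (x - y))\<^sup>2 \<le> bregman (balm_kernel t Q g) x y"
proof -
  define d where "d = x - y"
  have sym: "y \<bullet> (Q *v d) = d \<bullet> (Q *v y)"
    using inner_transpose [of d Q y] Q by (simp add: inner_commute)
  have x: "x = y + d"
    by (simp add: d_def)
  have grad: "gradient (balm_kernel t Q g) y = t *\<^sub>R y - Q *v y - gradient g y"
    by (intro gradient_eqI GDERIV_balm_kernel Q smooth_with_GDERIV [OF g])
  have "bregman (balm_kernel t Q g) x y = t / 2 * (norm d)\<^sup>2 - 1 / 2 * (d \<bullet> (Q *v d))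
      - (g x - g y - gradient g y \<bullet> d)"
    unfolding bregman_def grad balm_kernel_eq x
    by (simp add: power2_norm_eq_inner matrix_vector_right_distrib inner_simps sym inner_commute
        algebra_simps)
  moreover have "d \<bullet> (Q *v d) \<le> q * (norm d)\<^sup>2"
  proof -
    have "d \<bullet> (Q *v d) \<le> norm d * norm (Q *v d)"
      by (rule norm_cauchy_schwarz)
    also have "\<dots> \<le> norm d * (q * norm d)"
      by (intro mult_left_mono q) simp
    finally show ?thesis
      by (simp add: power2_eq_square algebra_simps)
  qed
  moreover have "g x - g y - gradient g y \<bullet> d \<le> lg / 2 * (norm d)\<^sup>2"
    unfolding d_def by (rule smooth_with_upper_bound [OF g])
  ultimately show ?thesis
    by (simp add: d_def [symmetric] algebra_simps)
qed

section \<open>Stationary points with prescribed positive components\<close>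

text \<open>Test the difference of the two gradient equations with \<open>x1 - x2\<close>. Since \<open>A (x1 - x2)\<close> is
  \<open>(z1 - z2) / \<rho> + (y1 - y2)\<close> for the multipliers \<open>z\<close>, this yields a vanishing sum of
  four terms: one is nonnegative by monotonicity of the gradient, two are squares, and the last is
  \<open>(z1 - z2) \<bullet> (y1 - y2)\<close>, which is nonnegative by complementarity. Complementarity is where
  the common set of positive entries enters: there both multipliers vanish, while on the other entries
  the multipliers are nonnegative and complementary to the nonpositive \<open>y\<close>.\<close>

lemma stationary_unique:
  fixes A :: "real ^ 'p ^ 'n" and zk :: "real ^ 'n"
  assumes f: "convex_on UNIV f" and df: "\<And>x. GDERIV f x :> gradient f x"
    and "lam > 0" "\<rho> > 0" "\<mu> > 0"
    and grad: "subproblem_grad f A b \<rho> \<mu> zk vk x1 y1 = 0" "subproblem_grad f A b \<rho> \<mu> zk vk x2 y2 = 0"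
    and prox: "y1 \<in> prox01 (1 / \<rho>) lam (A *v x1 + b + (1 / \<rho>) *\<^sub>R zk)"
      "y2 \<in> prox01 (1 / \<rho>) lam (A *v x2 + b + (1 / \<rho>) *\<^sub>R zk)"
    and pos: "\<And>i. y1 $ i > 0 \<longleftrightarrow> y2 $ i > 0"
  shows "x1 = x2 \<and> y1 = y2"
proof -
  define z where "z x y = zk + \<rho> *\<^sub>R (A *v x + b - y)" for x y
  define dz where "dz = z x1 y1 - z x2 y2"
  \<comment> \<open>In terms of \<open>z\<close>, the pair is a fixed point: \<open>y\<close> lies in the proximal set of \<open>y + z / \<rho>\<close>.\<close>
  have s: "A *v x + b + (1 / \<rho>) *\<^sub>R zk = y + (1 / \<rho>) *\<^sub>R z x y" for x y
    using \<open>\<rho> > 0\<close> by (simp add: z_def algebra_simps)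
  have active: "z x y $ i = 0" if "y \<in> prox01 (1 / \<rho>) lam (A *v x + b + (1 / \<rho>) *\<^sub>R zk)" "y $ i > 0"
    for x y i
    using prox01_component_pos(1) [OF that(1), of i] that(2) \<open>\<rho> > 0\<close> \<open>lam > 0\<close>
    by (simp add: s [of x y])
  have inactive: "z x y $ i \<ge> 0 \<and> z x y $ i * y $ i = 0"
    if "y \<in> prox01 (1 / \<rho>) lam (A *v x + b + (1 / \<rho>) *\<^sub>R zk)" "y $ i \<le> 0" for x y i
    using prox01_component_nonpos [OF that(1) _ that(2)] that(2) \<open>\<rho> > 0\<close>
    by (auto simp: s [of x y] min_def zero_le_divide_iff split: if_splits)
  have "0 \<le> dz $ i * (y1 - y2) $ i" for i
  proof (cases "y1 $ i > 0")
    case True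
    then show ?thesis
      using active [OF prox(1)] active [OF prox(2)] pos by (simp add: dz_def)
  next
    case False
    then have n: "y1 $ i \<le> 0" "y2 $ i \<le> 0"
      using pos [of i] by auto
    have "z x1 y1 $ i * y1 $ i = 0" "z x2 y2 $ i * y2 $ i = 0"
      using inactive [OF prox(1) n(1)] inactive [OF prox(2) n(2)] by auto
    then have "dz $ i * (y1 - y2) $ i = - (z x1 y1 $ i * y2 $ i) - z x2 y2 $ i * y1 $ i"
      by (simp only: dz_def vector_minus_component left_diff_distrib right_diff_distrib)
    moreover have "z x1 y1 $ i * y2 $ i \<le> 0" "z x2 y2 $ i * y1 $ i \<le> 0"
      using inactive [OF prox(1) n(1)] inactive [OF prox(2) n(2)] n
      by (auto intro: mult_nonneg_nonpos)
    ultimately show ?thesis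
      by linarith
  qed
  then have compl: "0 \<le> dz \<bullet> (y1 - y2)"
    by (simp add: inner_vec_def sum_nonneg)
  have Adx: "A *v (x1 - x2) = (1 / \<rho>) *\<^sub>R dz + (y1 - y2)"
    using \<open>\<rho> > 0\<close> by (simp add: dz_def z_def matrix_vector_mult_diff_distrib algebra_simps)
  have "(gradient f x1 - gradient f x2) + \<mu> *\<^sub>R (x1 - x2) + transpose A *v dz
      = subproblem_grad f A b \<rho> \<mu> zk vk x1 y1 - subproblem_grad f A b \<rho> \<mu> zk vk x2 y2"
    unfolding subproblem_grad_def dz_def z_def
    by (simp only: matrix_vector_mult_diff_distrib) (simp add: algebra_simps)
  then have "0 = (x1 - x2) \<bullet>
      ((gradient f x1 - gradient f x2) + \<mu> *\<^sub>R (x1 - x2) + transpose A *v dz)"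
    by (simp add: grad)
  also have "\<dots> = (gradient f x1 - gradient f x2) \<bullet> (x1 - x2) + \<mu> * (norm (x1 - x2))\<^sup>2
      + (1 / \<rho> * (norm dz)\<^sup>2 + dz \<bullet> (y1 - y2))"
    by (simp only: inner_add_right inner_transpose Adx)
      (simp add: power2_norm_eq_inner inner_add_left inner_add_right inner_commute)
  finally have sum0: "0 = \<dots>" .
  have "0 \<le> \<mu> * (norm (x1 - x2))\<^sup>2" "0 \<le> 1 / \<rho> * (norm dz)\<^sup>2"
    using \<open>\<mu> > 0\<close> \<open>\<rho> > 0\<close> by auto
  then have "\<mu> * (norm (x1 - x2))\<^sup>2 = 0" "1 / \<rho> * (norm dz)\<^sup>2 = 0"
    using sum0 compl convex_on_gradient_monotone [OF f df, of x1 x2] by linarith+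
  then have "x1 = x2" "dz = 0"
    using \<open>\<mu> > 0\<close> \<open>\<rho> > 0\<close> by auto
  then show ?thesis
    using Adx by simp
qed

lemma P_stationaryI:
  fixes A :: "real ^ 'p ^ 'n"
  assumes "\<rho> > 0" and "subproblem_grad f A b \<rho> \<mu> zk vk x y = 0"
    and prox: "y \<in> prox01 (1 / \<rho>) lam (A *v x + b + (1 / \<rho>) *\<^sub>R zk)"
  shows "P_stationary f A b lam \<rho> \<mu> zk vk (x, y)"
proof -
  have "A *v x + b + (1 / \<rho>) *\<^sub>R zk = y + (1 / \<rho>) *\<^sub>R (zk + \<rho> *\<^sub>R (A *v x + b - y))"
    using \<open>\<rho> > 0\<close> by (simp add: algebra_simps)
  then show ?thesis
    using assms unfolding P_stationary_def prod.case subproblem_grad_def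
    by (intro exI [of _ "zk + \<rho> *\<^sub>R (A *v x + b - y)"] exI [of _ "1 / \<rho>"]) auto
qed

section \<open>Convergence from uniqueness of the accumulation point\<close>

lemma bounded_sequence_accumulation_point:
  fixes X :: "nat \<Rightarrow> 'a::heine_borel"
  assumes "bounded (range X)"
  obtains x where "accumulation_point X x"
  using bounded_imp_convergent_subsequence [OF assms] unfolding accumulation_point_def by blast

text \<open>Otherwise a subsequence stays away from \<open>x\<close>, and by compactness it has an accumulation point
  of its own, which is one of the whole sequence.\<close>

lemma bounded_unique_accumulation_point_imp_tendsto:
  fixes X :: "nat \<Rightarrow> 'a::heine_borel"
  assumes bdd: "bounded (range X)" and uniq: "\<And>y. accumulation_point X y \<Longrightarrow> y = x"
  shows "X \<longlonglongrightarrow> x"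
proof (rule ccontr)
  assume "\<not> X \<longlonglongrightarrow> x"
  then obtain e where e: "e > 0" and "\<not> (\<forall>\<^sub>F n in sequentially. dist (X n) x < e)"
    unfolding tendsto_iff by blast
  then have "infinite {n. e \<le> dist (X n) x}"
    by (auto simp: eventually_sequentially infinite_nat_iff_unbounded_le not_less)
  then obtain r :: "nat \<Rightarrow> nat" where r: "strict_mono r" "\<And>n. e \<le> dist (X (r n)) x"
    using infinite_enumerate by blast
  have "bounded (range (X \<circ> r))"
    by (rule bounded_subset [OF bdd]) auto
  then obtain y where "accumulation_point (X \<circ> r) y"
    by (rule bounded_sequence_accumulation_point)
  then obtain r' :: "nat \<Rightarrow> nat" where r': "strict_mono r'" "(X \<circ> r \<circ> r') \<longlonglongrightarrow> y"
    unfolding accumulation_point_def by blast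
  have "accumulation_point X y"
    unfolding accumulation_point_def
    using r' strict_mono_o [OF r(1) r'(1)] by (auto simp: comp_assoc)
  then have "(X \<circ> r \<circ> r') \<longlonglongrightarrow> x"
    using r' uniq by blast
  then have "\<forall>\<^sub>F n in sequentially. dist ((X \<circ> r \<circ> r') n) x < e"
    using e by (rule tendstoD)
  moreover have "\<not> dist ((X \<circ> r \<circ> r') n) x < e" for n
    using r(2) [of "r' n"] by simp
  ultimately show False
    by simp
qed

section \<open>The iteration\<close>

locale balm_iteration =
  fixes f g :: "real ^ 'p \<Rightarrow> real"
    and A :: "real ^ 'p ^ 'n" and b :: "real ^ 'n"
    and lam \<rho> \<mu> t q lf lg :: real
    and Q :: "nat \<Rightarrow> real ^ 'p ^ 'p"
    and vk :: "real ^ 'p" and zk :: "real ^ 'n"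
    and w :: "nat \<Rightarrow> real ^ 'p" and u :: "nat \<Rightarrow> real ^ 'n"
  assumes lam_pos: "lam > 0" and rho_pos: "\<rho> > 0" and mu_pos: "\<mu> > 0" and t_pos: "t > 0"
    and f_smooth: "smooth_with lf f" and f_bdd: "bdd_below (range f)"
    and A_rank: "rank A = CARD('n)"
    and g_smooth: "smooth_with lg g"
    and Q_sym: "\<And>j. transpose (Q j) = Q j"
    and Q_norm: "\<And>j x. norm (Q j *v x) \<le> q * norm x"
    and t_gt: "t > q + lg"
    and sequence:
      "balm_sequence f A b lam \<rho> \<mu> (1 / \<rho>) t Q g (w 0) (u 0) zk vk w u"
begin

abbreviation "V x y \<equiv> lyapunov f A b lam \<rho> \<mu> x y zk vk"
abbreviation "G x y \<equiv> subproblem_grad f A b \<rho> \<mu> zk vk x y"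
abbreviation "prox_arg x \<equiv> A *v x + b + (1 / \<rho>) *\<^sub>R zk"

text \<open>The step length \<open>1 / \<rho>\<close> cancels the previous \<open>u j\<close>: the proximal operator is applied at a point
  that depends on \<open>w j\<close> alone.\<close>

lemma u_step: "u (Suc j) \<in> prox01 (1 / \<rho>) lam (prox_arg (w j))"
proof -
  have "gradient (\<lambda>y. subproblem_smooth f A b \<rho> \<mu> zk vk (w j) y) (u j)
      = - zk - \<rho> *\<^sub>R (A *v w j + b - u j)"
    by (intro gradient_eqI GDERIV_subproblem_u)
  moreover have "u j - (1 / \<rho>) *\<^sub>R (- zk - \<rho> *\<^sub>R (A *v w j + b - u j)) = prox_arg (w j)"
    using rho_pos by (simp add: algebra_simps)
  ultimately show ?thesis
    using sequence unfolding balm_sequence_def by metis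
qed

lemma w_step:
  "w (Suc j) \<in> argmin (\<lambda>x. subproblem_smooth f A b \<rho> \<mu> zk vk x (u (Suc j))
      + bregman (balm_kernel t (Q j) g) x (w j))"
  using sequence unfolding balm_sequence_def by blast

text \<open>The \<open>u\<close>-step does not increase \<open>V\<close>; the \<open>w\<close>-step, compared with staying at \<open>w j\<close>, where the
  Bregman distance vanishes, decreases it by at least that distance.\<close>

lemma descent:
  "(t - q - lg) / 2 * (norm (w (Suc j) - w j))\<^sup>2 \<le> V (w j) (u j) - V (w (Suc j)) (u (Suc j))"
proof -
  have "V (w j) (u (Suc j)) \<le> V (w j) (u j)"
    using u_step [of j] by (simp add: lyapunov_complete_square [OF rho_pos] prox01_def argmin_iff)
  moreover have "V (w (Suc j)) (u (Suc j)) + bregman (balm_kernel t (Q j) g) (w (Suc j)) (w j)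
      \<le> V (w j) (u (Suc j))"
    using w_step [of j, unfolded argmin_iff, rule_format, of "w j"]
    by (simp add: lyapunov_eq_subproblem bregman_def [of _ "w j" "w j"])
  moreover have "(t - q - lg) / 2 * (norm (w (Suc j) - w j))\<^sup>2
      \<le> bregman (balm_kernel t (Q j) g) (w (Suc j)) (w j)"
    by (rule bregman_balm_kernel_ge [OF Q_sym Q_norm g_smooth])
  ultimately show ?thesis
    by linarith
qed

lemma zeta_pos: "t - q - lg > 0"
  using t_gt by simp

lemma V_decseq: "decseq (\<lambda>j. V (w j) (u j))"
proof (rule decseq_SucI)
  fix j
  have "0 \<le> (t - q - lg) / 2 * (norm (w (Suc j) - w j))\<^sup>2"
    using zeta_pos by simp
  then show "V (w (Suc j)) (u (Suc j)) \<le> V (w j) (u j)"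
    using descent [of j] by linarith
qed

lemma V_lower_bound:
  obtains m where "\<And>x y. m + \<mu> / 2 * (norm (x - vk))\<^sup>2 + \<rho> / 2 * (norm (y - prox_arg x))\<^sup>2 \<le> V x y"
proof -
  obtain m where m: "\<And>x. m \<le> f x"
    using f_bdd by (auto simp: bdd_below_def)
  show thesis
  proof (rule that [of "m - (norm zk)\<^sup>2 / (2 * \<rho>)"])
    fix x y
    show "m - (norm zk)\<^sup>2 / (2 * \<rho>) + \<mu> / 2 * (norm (x - vk))\<^sup>2
        + \<rho> / 2 * (norm (y - prox_arg x))\<^sup>2 \<le> V x y"
      using m [of x] lam_pos by (simp add: lyapunov_complete_square [OF rho_pos] add_increasing2)
  qed
qed

lemma dw_tendsto_0: "(\<lambda>j. norm (w (Suc j) - w j)) \<longlonglongrightarrow> 0"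
proof -
  obtain m where m:
    "\<And>x y. m + \<mu> / 2 * (norm (x - vk))\<^sup>2 + \<rho> / 2 * (norm (y - prox_arg x))\<^sup>2 \<le> V x y"
    by (rule V_lower_bound) blast
  have "m \<le> V x y" for x y
  proof -
    have "0 \<le> \<mu> / 2 * (norm (x - vk))\<^sup>2" "0 \<le> \<rho> / 2 * (norm (y - prox_arg x))\<^sup>2"
      using mu_pos rho_pos by auto
    then show ?thesis
      using m [of x y] by linarith
  qed
  then obtain L where L: "(\<lambda>j. V (w j) (u j)) \<longlonglongrightarrow> L"
    using decseq_convergent [OF V_decseq, of m] by blast
  have "(\<lambda>j. V (w j) (u j) - V (w (Suc j)) (u (Suc j))) \<longlonglongrightarrow> 0"
    using tendsto_diff [OF L LIMSEQ_Suc [OF L]] by simp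
  then have V0: "(\<lambda>j. 2 / (t - q - lg) * (V (w j) (u j) - V (w (Suc j)) (u (Suc j)))) \<longlonglongrightarrow> 0"
    by (rule tendsto_mult_right_zero)
  have "(\<lambda>j. (norm (w (Suc j) - w j))\<^sup>2) \<longlonglongrightarrow> 0"
  proof (rule tendsto_sandwich [OF _ _ tendsto_const V0])
    show "\<forall>\<^sub>F j in sequentially. (norm (w (Suc j) - w j))\<^sup>2
        \<le> 2 / (t - q - lg) * (V (w j) (u j) - V (w (Suc j)) (u (Suc j)))"
      using descent zeta_pos by (simp add: field_simps)
  qed simp
  then show ?thesis
    by (simp add: power_tendsto_0_iff)
qed

lemma bounded_iterates: "bounded (range (\<lambda>j. (w j, u j)))"
proof -
  obtain m where m:
    "\<And>x y. m + \<mu> / 2 * (norm (x - vk))\<^sup>2 + \<rho> / 2 * (norm (y - prox_arg x))\<^sup>2 \<le> V x y"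
    by (rule V_lower_bound) blast
  define C where "C = V (w 0) (u 0) - m"
  have C: "\<mu> / 2 * (norm (w j - vk))\<^sup>2 + \<rho> / 2 * (norm (u j - prox_arg (w j)))\<^sup>2 \<le> C" for j
    using m [of "w j" "u j"] decseqD [OF V_decseq, of 0 j] by (simp add: C_def)
  have nn: "0 \<le> \<mu> / 2 * (norm (w j - vk))\<^sup>2" "0 \<le> \<rho> / 2 * (norm (u j - prox_arg (w j)))\<^sup>2" for j
    using mu_pos rho_pos by auto
  have "norm (w j - vk) \<le> sqrt (2 * C / \<mu>)" for j
    using C [of j] nn(2) [of j] mu_pos by (intro real_le_rsqrt) (simp add: field_simps)
  then have "norm (w j) \<le> norm vk + sqrt (2 * C / \<mu>)" for j
    using norm_triangle_sub [of "w j" vk] by (meson add_left_mono order_trans)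
  then have w: "bounded (range w)"
    by (auto simp: bounded_iff)
  have "bounded ((*v) A ` range w)"
    by (rule bounded_linear_image [OF w matrix_vector_mul_bounded_linear])
  then obtain B where B: "\<And>j. norm (A *v w j) \<le> B"
    by (auto simp: bounded_iff)
  have ud: "norm (u j - prox_arg (w j)) \<le> sqrt (2 * C / \<rho>)" for j
    using C [of j] nn(1) [of j] rho_pos by (intro real_le_rsqrt) (simp add: field_simps)
  have "norm (u j) \<le> B + norm b + norm ((1 / \<rho>) *\<^sub>R zk) + sqrt (2 * C / \<rho>)" for j
  proof -
    have "norm (u j) \<le> norm (prox_arg (w j)) + norm (u j - prox_arg (w j))"
      by (rule norm_triangle_sub)
    also have "norm (prox_arg (w j)) \<le> norm (A *v w j) + norm b + norm ((1 / \<rho>) *\<^sub>R zk)"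
      by (metis norm_triangle_le norm_triangle_ineq add_right_mono)
    finally show ?thesis
      using B [of j] ud [of j] by linarith
  qed
  then have "bounded (range u)"
    unfolding bounded_iff by (metis rangeE)
  then have "bounded (range w \<times> range u)"
    by (rule bounded_Times [OF w])
  then show ?thesis
    by (rule bounded_subset) auto
qed

text \<open>Fermat's rule for the \<open>w\<close>-step; the right-hand side is the negated change of the gradient of the
  kernel.\<close>

lemma w_optimality:
  "G (w (Suc j)) (u (Suc j)) = (gradient g (w (Suc j)) - gradient g (w j))
     - (t *\<^sub>R (w (Suc j) - w j) - Q j *v (w (Suc j) - w j))"
proof -
  have k: "GDERIV (balm_kernel t (Q j) g) x :> t *\<^sub>R x - Q j *v x - gradient g x" for x
    by (intro GDERIV_balm_kernel Q_sym smooth_with_GDERIV [OF g_smooth])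
  have "G (w (Suc j)) (u (Suc j)) + ((t *\<^sub>R w (Suc j) - Q j *v w (Suc j) - gradient g (w (Suc j)))
      - gradient (balm_kernel t (Q j) g) (w j)) = 0"
    by (rule GDERIV_argmin_eq_0 [OF w_step [of j]]) (intro GDERIV_add GDERIV_bregman k GDERIV_subproblem_w
        smooth_with_GDERIV [OF f_smooth])
  then show ?thesis
    unfolding gradient_eqI [OF k]
    by (simp add: matrix_vector_mult_diff_distrib algebra_simps)
qed

text \<open>By the optimality condition, the gradient after a step is at most a multiple of the length of
  that step.\<close>

lemma G_tendsto_0: "(\<lambda>j. G (w j) (u j)) \<longlonglongrightarrow> 0"
proof (subst filterlim_sequentially_Suc [symmetric], rule Lim_null_comparison)
  show "(\<lambda>j. (lg + t + q) * norm (w (Suc j) - w j)) \<longlonglongrightarrow> 0"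
    by (rule tendsto_mult_right_zero [OF dw_tendsto_0])
  show "\<forall>\<^sub>F j in sequentially.
      norm (G (w (Suc j)) (u (Suc j))) \<le> (lg + t + q) * norm (w (Suc j) - w j)"
  proof (intro always_eventually allI)
    fix j
    define d where "d = w (Suc j) - w j"
    have "norm (G (w (Suc j)) (u (Suc j)))
        \<le> norm (gradient g (w (Suc j)) - gradient g (w j)) + (norm (t *\<^sub>R d) + norm (Q j *v d))"
      unfolding w_optimality d_def [symmetric]
      by (rule order_trans [OF norm_triangle_ineq4 add_left_mono [OF norm_triangle_ineq4]])
    also have "\<dots> \<le> lg * norm d + (t * norm d + q * norm d)"
      using smooth_with_gradient_diff_le [OF g_smooth, of "w (Suc j)" "w j"] Q_norm [of j d] t_pos
      by (simp add: d_def)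
    finally show "norm (G (w (Suc j)) (u (Suc j))) \<le> (lg + t + q) * norm (w (Suc j) - w j)"
      by (simp add: d_def algebra_simps)
  qed
qed

text \<open>In the change of \<open>G\<close> from one iterate to the next, all terms but the one with
  \<open>A\<^sup>T (u (Suc j) - u j)\<close> are controlled by the step in \<open>w\<close>. Full row rank makes \<open>A\<^sup>T\<close> bounded
  below, so the step in \<open>u\<close> is controlled as well.\<close>

lemma du_tendsto_0: "(\<lambda>j. norm (u (Suc j) - u j)) \<longlonglongrightarrow> 0"
proof -
  have "rank (transpose A) = CARD('n)"
    using A_rank by (simp add: rank_transpose)
  then have "inj ((*v) (transpose A))"
    by (simp add: full_rank_injective)
  then obtain B where B: "B > 0" "\<And>x. B * norm x \<le> norm (transpose A *v x)"
    using linear_inj_bounded_below_pos [OF matrix_vector_mul_linear] by blast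
  have dw: "(\<lambda>j. w (Suc j) - w j) \<longlonglongrightarrow> 0"
    using dw_tendsto_0 by (simp add: tendsto_norm_zero_iff)
  have df: "(\<lambda>j. gradient f (w (Suc j)) - gradient f (w j)) \<longlonglongrightarrow> 0"
  proof (rule Lim_null_comparison)
    show "(\<lambda>j. lf * norm (w (Suc j) - w j)) \<longlonglongrightarrow> 0"
      by (rule tendsto_mult_right_zero [OF dw_tendsto_0])
  qed (simp add: smooth_with_gradient_diff_le [OF f_smooth])
  have dA: "(\<lambda>j. transpose A *v (A *v (w (Suc j) - w j))) \<longlonglongrightarrow> 0"
    by (intro bounded_linear.tendsto_zero [OF matrix_vector_mul_bounded_linear] dw)
  have eq: "\<rho> *\<^sub>R (transpose A *v (u (Suc j) - u j)) = (gradient f (w (Suc j)) - gradient f (w j))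
      + \<mu> *\<^sub>R (w (Suc j) - w j) + \<rho> *\<^sub>R (transpose A *v (A *v (w (Suc j) - w j)))
      - (G (w (Suc j)) (u (Suc j)) - G (w j) (u j))" for j
    by (simp add: subproblem_grad_def matrix_vector_right_distrib matrix_vector_mult_diff_distrib
        matrix_vector_mult_scaleR algebra_simps)
  have "(\<lambda>j. \<rho> *\<^sub>R (transpose A *v (u (Suc j) - u j))) \<longlonglongrightarrow> 0 + \<mu> *\<^sub>R 0 + \<rho> *\<^sub>R 0 - (0 - 0)"
    unfolding eq by (intro tendsto_intros df dw dA G_tendsto_0 LIMSEQ_Suc [OF G_tendsto_0])
  then have "(\<lambda>j. norm (\<rho> *\<^sub>R (transpose A *v (u (Suc j) - u j)))) \<longlonglongrightarrow> 0"
    by (intro tendsto_norm_zero) simp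
  then have lim: "(\<lambda>j. 1 / (\<rho> * B) * norm (\<rho> *\<^sub>R (transpose A *v (u (Suc j) - u j)))) \<longlonglongrightarrow> 0"
    by (rule tendsto_mult_right_zero)
  show ?thesis
  proof (rule tendsto_sandwich [OF _ _ tendsto_const lim])
    show "\<forall>\<^sub>F j in sequentially. norm (u (Suc j) - u j)
        \<le> 1 / (\<rho> * B) * norm (\<rho> *\<^sub>R (transpose A *v (u (Suc j) - u j)))"
      using B rho_pos by (simp add: field_simps)
  qed simp
qed

lemma accumulation_point_stationary:
  assumes "accumulation_point (\<lambda>j. (w j, u j)) (x, y)"
  shows "G x y = 0" and "y \<in> prox01 (1 / \<rho>) lam (prox_arg x)"
proof -
  obtain r :: "nat \<Rightarrow> nat" where r: "strict_mono r" and lim: "((\<lambda>j. (w j, u j)) \<circ> r) \<longlonglongrightarrow> (x, y)"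
    using assms unfolding accumulation_point_def by blast
  have wr: "(\<lambda>j. w (r j)) \<longlonglongrightarrow> x" and ur: "(\<lambda>j. u (r j)) \<longlonglongrightarrow> y"
    using tendsto_fst [OF lim] tendsto_snd [OF lim] by (simp_all add: comp_def)
  have "continuous_on UNIV (gradient f)"
    using f_smooth by (auto simp: smooth_with_def intro: lipschitz_on_continuous_on)
  then have "isCont (gradient f) x"
    by (simp add: continuous_on_eq_continuous_at)
  then have fr: "(\<lambda>j. gradient f (w (r j))) \<longlonglongrightarrow> gradient f x"
    using wr by (rule isCont_tendsto_compose)
  have "(\<lambda>j. G (w (r j)) (u (r j))) \<longlonglongrightarrow> G x y"
    unfolding subproblem_grad_def
    by (intro tendsto_intros fr wr ur
        bounded_linear.tendsto [OF matrix_vector_mul_bounded_linear])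
  moreover have "(\<lambda>j. G (w (r j)) (u (r j))) \<longlonglongrightarrow> 0"
    using LIMSEQ_subseq_LIMSEQ [OF G_tendsto_0 r] by (simp add: comp_def)
  ultimately show "G x y = 0"
    by (rule LIMSEQ_unique)
  \<comment> \<open>The proximal inclusion links \<open>u\<close> at index \<open>Suc (r j)\<close> with \<open>w\<close> at \<open>r j\<close>; as the steps in \<open>u\<close>
    vanish, the index shift does not affect the limit.\<close>
  have du: "(\<lambda>j. u (Suc (r j)) - u (r j)) \<longlonglongrightarrow> 0"
    using LIMSEQ_subseq_LIMSEQ [OF du_tendsto_0 r] by (simp add: comp_def tendsto_norm_zero_iff)
  have u': "(\<lambda>j. u (Suc (r j))) \<longlonglongrightarrow> y"
    using tendsto_add [OF du ur] by simp
  have "(\<lambda>j. prox_arg (w (r j))) \<longlonglongrightarrow> prox_arg x"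
    by (intro tendsto_intros wr bounded_linear.tendsto [OF matrix_vector_mul_bounded_linear])
  from prox01_closed_graph [OF u_step u' this] show "y \<in> prox01 (1 / \<rho>) lam (prox_arg x)"
    using lam_pos by simp
qed

lemma positive_components_bounded_below:
  assumes "u (Suc j) $ i > 0"
  shows "sqrt (2 * lam / \<rho>) \<le> u (Suc j) $ i"
  using prox01_component_pos(2) [OF u_step _ assms] assms rho_pos lam_pos
  by (intro real_le_lsqrt) auto

text \<open>An entry that switches between positive and nonpositive has to jump across the gap. The bound
  holds for outputs of the \<open>u\<close>-step only, hence the index \<open>Suc j\<close>: the starting point is
  arbitrary.\<close>

lemma positive_components_eventually_constant:
  obtains N S where "\<And>j. N \<le> j \<Longrightarrow> {i. u (Suc j) $ i > 0} = S"
proof -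
  define c where "c = sqrt (2 * lam / \<rho>)"
  have "c > 0"
    using lam_pos rho_pos by (simp add: c_def)
  then obtain N where N: "\<And>j. N \<le> j \<Longrightarrow> norm (u (Suc j) - u j) < c"
    using order_tendstoD(2) [OF du_tendsto_0] unfolding eventually_sequentially by blast
  have step: "{i. u (Suc (Suc j)) $ i > 0} = {i. u (Suc j) $ i > 0}" if "N \<le> j" for j
  proof -
    have "\<bar>u (Suc (Suc j)) $ i - u (Suc j) $ i\<bar> < c" for i
      using N [of "Suc j"] that component_le_norm_cart [of "u (Suc (Suc j)) - u (Suc j)" i] by simp
    then show ?thesis
      using positive_components_bounded_below [of j] positive_components_bounded_below [of "Suc j"]
      unfolding c_def [symmetric] by (smt (verit) Collect_cong)
  qed
  show thesis
  proof (rule that)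
    fix j
    assume "N \<le> j"
    then show "{i. u (Suc j) $ i > 0} = {i. u (Suc N) $ i > 0}"
      by (induction j rule: dec_induct) (simp_all add: step)
  qed
qed

lemma convex_tendsto_stationary:
  assumes f: "convex_on UNIV f"
  shows "\<exists>x. P_stationary f A b lam \<rho> \<mu> zk vk x \<and> (\<lambda>j. (w j, u j)) \<longlonglongrightarrow> x"
proof -
  obtain N S where S: "\<And>j. N \<le> j \<Longrightarrow> {i. u (Suc j) $ i > 0} = S"
    using positive_components_eventually_constant by metis
  \<comment> \<open>Positivity could be lost in a limit; the uniform lower bound on positive entries prevents it.\<close>
  have pos: "y $ i > 0 \<longleftrightarrow> i \<in> S" if acc: "accumulation_point (\<lambda>j. (w j, u j)) (x, y)" for x y i
  proof -
    obtain r :: "nat \<Rightarrow> nat" where r: "strict_mono r" and lim: "((\<lambda>j. (w j, u j)) \<circ> r) \<longlonglongrightarrow> (x, y)"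
      using acc unfolding accumulation_point_def by blast
    have ur: "(\<lambda>j. u (r j) $ i) \<longlonglongrightarrow> y $ i"
      using tendsto_vec_nth [OF tendsto_snd [OF lim], of i] by (simp add: comp_def)
    have large: "\<forall>\<^sub>F j in sequentially. Suc N \<le> r j"
      using filterlim_subseq [OF r] by (simp add: filterlim_at_top)
    show ?thesis
    proof
      assume "i \<in> S"
      have "\<forall>\<^sub>F j in sequentially. sqrt (2 * lam / \<rho>) \<le> u (r j) $ i"
        using large
      proof eventually_elim
        case (elim j)
        then obtain k where "r j = Suc k" "N \<le> k"
          by (cases "r j") auto
        then show ?case
          using S [of k] \<open>i \<in> S\<close> positive_components_bounded_below [of k i] by auto
      qed
      then have "sqrt (2 * lam / \<rho>) \<le> y $ i"
        using tendsto_lowerbound [OF ur] by simp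
      moreover have "0 < sqrt (2 * lam / \<rho>)"
        using lam_pos rho_pos by simp
      ultimately show "y $ i > 0"
        by linarith
    next
      assume "y $ i > 0"
      then have "\<forall>\<^sub>F j in sequentially. 0 < u (r j) $ i"
        by (rule order_tendstoD(1) [OF ur])
      with large have "\<forall>\<^sub>F j in sequentially. i \<in> S"
      proof eventually_elim
        case (elim j)
        then obtain k where "r j = Suc k" "N \<le> k"
          by (cases "r j") auto
        then show ?case
          using S [of k] elim by auto
      qed
      then show "i \<in> S"
        by simp
    qed
  qed
  obtain x y where xy: "accumulation_point (\<lambda>j. (w j, u j)) (x, y)"
    using bounded_sequence_accumulation_point [OF bounded_iterates] by (metis surj_pair)
  have "(\<lambda>j. (w j, u j)) \<longlonglongrightarrow> (x, y)"
  proof (rule bounded_unique_accumulation_point_imp_tendsto [OF bounded_iterates])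
    fix p
    assume "accumulation_point (\<lambda>j. (w j, u j)) p"
    then obtain x' y' where p: "p = (x', y')" "accumulation_point (\<lambda>j. (w j, u j)) (x', y')"
      by (cases p) auto
    have "x' = x \<and> y' = y"
      using f smooth_with_GDERIV [OF f_smooth] lam_pos rho_pos mu_pos
        accumulation_point_stationary(1) [OF p(2)] accumulation_point_stationary(1) [OF xy]
        accumulation_point_stationary(2) [OF p(2)] accumulation_point_stationary(2) [OF xy]
    proof (rule stationary_unique)
      show "y' $ i > 0 \<longleftrightarrow> y $ i > 0" for i
        using pos [OF p(2)] pos [OF xy] by simp
    qed
    then show "p = (x, y)"
      using p by simp
  qed
  then show ?thesis
    using P_stationaryI [OF rho_pos accumulation_point_stationary [OF xy]] by blast
qed

end

theorem theorem4:
  fixes f g :: "real ^ 'p \<Rightarrow> real"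
    and A :: "real ^ 'p ^ 'n" and b :: "real ^ 'n"
    and lam \<rho> \<mu> \<alpha> t q lf lg \<zeta> :: real
    and Q :: "nat \<Rightarrow> real ^ 'p ^ 'p"
    and wk vk :: "real ^ 'p" and uk zk :: "real ^ 'n"
    and w :: "nat \<Rightarrow> real ^ 'p" and u :: "nat \<Rightarrow> real ^ 'n"
  assumes "lam > 0" and "\<rho> > 0" and "\<mu> > 0" and "t > 0" and "q > 0"
    and "cont_diff f" and "smooth_with lf f" and "bdd_below (range f)"
    and "rank A = CARD('n)"
    and "smooth_with lg g"
    and "\<forall>j. sym_psd (Q j)"
    and "\<alpha> = 1 / \<rho>"
    and "(SUP j. ereal (onorm ((*v) (Q j)))) \<le> ereal q"
    and "t > q + lg"
    and "\<zeta> = t - q - lg"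
    and "balm_sequence f A b lam \<rho> \<mu> \<alpha> t Q g wk uk zk vk w u"
  shows
    "(\<zeta> > 0 \<and>
      (\<forall>j. lyapunov f A b lam \<rho> \<mu> (w j) (u j) zk vk
             - lyapunov f A b lam \<rho> \<mu> (w (Suc j)) (u (Suc j)) zk vk
           \<ge> \<zeta> / 2 * (norm (w (Suc j) - w j))\<^sup>2)) \<and>
     ((\<lambda>j. norm (w (Suc j) - w j)) \<longlonglongrightarrow> 0 \<and> (\<lambda>j. norm (u (Suc j) - u j)) \<longlonglongrightarrow> 0) \<and>
     bounded (range (\<lambda>j. (w j, u j))) \<and>
     ((\<forall>x. accumulation_point (\<lambda>j. (w j, u j)) x \<longrightarrow> P_stationary f A b lam \<rho> \<mu> zk vk x) \<and>
      (\<lambda>j. gradient (\<lambda>x. subproblem_smooth f A b \<rho> \<mu> zk vk x (u j)) (w j)) \<longlonglongrightarrow> 0) \<and>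
     (convex_on UNIV f \<longrightarrow>
      (\<exists>x. P_stationary f A b lam \<rho> \<mu> zk vk x \<and> (\<lambda>j. (w j, u j)) \<longlonglongrightarrow> x))"
proof -
  have Q_norm: "norm (Q j *v x) \<le> q * norm x" for j x
  proof -
    have "ereal (onorm ((*v) (Q j))) \<le> ereal q"
      by (rule order_trans [OF SUP_upper assms(13)]) simp
    then have "onorm ((*v) (Q j)) * norm x \<le> q * norm x"
      by (intro mult_right_mono) auto
    then show ?thesis
      using onorm [OF matrix_vector_mul_bounded_linear, of "Q j" x] by linarith
  qed
  interpret balm_iteration f g A b lam \<rho> \<mu> t q lf lg Q vk zk w u
    using assms Q_norm by unfold_locales (auto simp: sym_psd_def balm_sequence_def)
  have "gradient (\<lambda>x. subproblem_smooth f A b \<rho> \<mu> zk vk x (u j)) (w j) = G (w j) (u j)" for j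
    by (intro gradient_eqI GDERIV_subproblem_w smooth_with_GDERIV [OF f_smooth])
  then have "(\<lambda>j. gradient (\<lambda>x. subproblem_smooth f A b \<rho> \<mu> zk vk x (u j)) (w j)) \<longlonglongrightarrow> 0"
    using G_tendsto_0 by simp
  moreover have "P_stationary f A b lam \<rho> \<mu> zk vk x"
    if "accumulation_point (\<lambda>j. (w j, u j)) x" for x
    using P_stationaryI [OF rho_pos accumulation_point_stationary] that by (cases x) simp
  ultimately show ?thesis
    using zeta_pos descent dw_tendsto_0 du_tendsto_0 bounded_iterates convex_tendsto_stationary
    unfolding \<open>\<zeta> = t - q - lg\<close> by blast
qed

end
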